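(* Let $\xi$ be a standard normal random variable. There exists a universal constant $C_P > 0$ such that $$\limsup_{n \rightarrow \infty} \rho_\lambda\left(\xi,\sum_{k=1}^n \xi_{n,k}\right) \leq C_P\, \mathrm{Lin}\left(\{\xi_{n,k}\}\right)$$ for all $\lambda > 0$ and all standard triangular arrays $\{\xi_{n,k}\}$ which satisfy Feller's condition, where $\rho_\lambda$ is the parametrized Prokhorov distance and $\mathrm{Lin}$ is the Lindeberg index. Moreover, $C_P$ can be taken equal to $4$.
   Context: All random variables are real-valued and defined on a fixed probability space $(\Omega,\mathcal{F},\mathbb{P})$. A standard triangular array (STA) is a family $\{\xi_{n,k}\}_{n \geq 1,\, 1 \leq k \leq n}$ of random variables such that $\xi_{n,1},\ldots,\xi_{n,n}$ are independent for all $n$, $\mathbb{E}[\xi_{n,k}] = 0$ for all $n,k$, and $\sum_{k=1}^n \mathbb{E}[\xi_{n,k}^2] = 1$ for all $n$. It satisfies Feller's condition iff $\lim_{n \rightarrow \infty} \max_{1 \leq k \leq n} \mathbb{E}[\xi_{n,k}^2] = 0$. For a random variable $X$ and an event $A$, $\mathbb{E}[X ; A]$ denotes $\mathbb{E}[X \mathbf{1}_A]$. The Lindeberg index of an STA is $$\mathrm{Lin}\left(\{\xi_{n,k}\}\right) = \sup_{\epsilon > 0} \limsup_{n \rightarrow \infty} \sum_{k=1}^n \mathbb{E}\left[\xi_{n,k}^2 ; \left|\xi_{n,k}\right| > \epsilon\right].$$ For $\lambda > 0$ and Borel probability measures $P,Q$ on $\mathbb{R}$, the parametrized Prokhorov distance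 $\rho_\lambda(P,Q)$ is the infimum of all $\alpha > 0$ for which the inequality $P[A] \leq Q\left[A^{(\lambda \alpha)}\right] + \alpha$ holds for every Borel set $A \subset \mathbb{R}$, where $A^{(\lambda\alpha)} = \{x \in \mathbb{R} \mid \inf_{a \in A} |x-a| \leq \lambda \alpha\}$ (with $\inf \emptyset = \infty$, so $\emptyset^{(\lambda\alpha)} = \emptyset$). The distance $\rho_\lambda$ between two random variables is the distance $\rho_\lambda$ between their distributions. The constant $C_P$ being universal means that it depends neither on the array nor on $\lambda$. *)

theory Defs
  imports "HOL-Probability.Probability"
begin

definition standard_triangular_array ::
  "'a measure \<Rightarrow> (nat \<Rightarrow> nat \<Rightarrow> 'a \<Rightarrow> real) \<Rightarrow> bool" where
  \<comment> \<open>Only the entries \<open>X n k\<close> with \<open>1 \<le> k \<le> n\<close> matter. Independence includes measurability;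
     integrability of the squares is explicit because the Bochner integral of a
     non-integrable function is \<open>0\<close>.\<close>
  "standard_triangular_array M X \<longleftrightarrow>
     (\<forall>n\<ge>1.
        prob_space.indep_vars M (\<lambda>_. borel) (X n) {1..n} \<and>
        (\<forall>k\<in>{1..n}. integrable M (\<lambda>\<omega>. (X n k \<omega>)\<^sup>2) \<and>
                     (\<integral>\<omega>. X n k \<omega> \<partial>M) = 0) \<and>
        (\<Sum>k=1..n. \<integral>\<omega>. (X n k \<omega>)\<^sup>2 \<partial>M) = 1)"

definition feller_condition ::
  "'a measure \<Rightarrow> (nat \<Rightarrow> nat \<Rightarrow> 'a \<Rightarrow> real) \<Rightarrow> bool" where
  "feller_condition M X \<longleftrightarrow>
     (\<lambda>n. Max ((\<lambda>k. \<integral>\<omega>. (X n k \<omega>)\<^sup>2 \<partial>M) ` {1..n})) \<longlonglongrightarrow> 0"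

definition lindeberg_index ::
  "'a measure \<Rightarrow> (nat \<Rightarrow> nat \<Rightarrow> 'a \<Rightarrow> real) \<Rightarrow> ereal" where
  "lindeberg_index M X =
     (SUP \<epsilon>\<in>{0::real<..}. limsup (\<lambda>n. ereal
        (\<Sum>k=1..n. LINT \<omega>:{\<omega>\<in>space M. \<bar>X n k \<omega>\<bar> > \<epsilon>}|M. (X n k \<omega>)\<^sup>2)))"

definition closed_enlargement :: "real set \<Rightarrow> real \<Rightarrow> real set" where
  \<comment> \<open>The infimum is taken in \<open>ereal\<close>, so that over the empty set it is \<open>\<infinity>\<close>
     (whereas \<open>infdist x {} = 0\<close>).\<close>
  "closed_enlargement A \<delta> = {x. (INF a\<in>A. ereal \<bar>x - a\<bar>) \<le> ereal \<delta>}"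

definition prokhorov_dist :: "real \<Rightarrow> real measure \<Rightarrow> real measure \<Rightarrow> real" where
  \<comment> \<open>For probability measures the set contains \<open>1\<close>, so the real infimum is genuine.\<close>
  "prokhorov_dist l P Q =
     Inf {\<alpha>. \<alpha> > 0 \<and>
             (\<forall>A\<in>sets borel. measure P A \<le> measure Q (closed_enlargement A (l * \<alpha>)) + \<alpha>)}"

definition prokhorov_dist_rv ::
  "'a measure \<Rightarrow> real \<Rightarrow> ('a \<Rightarrow> real) \<Rightarrow> ('a \<Rightarrow> real) \<Rightarrow> real" where
  "prokhorov_dist_rv M l X Y = prokhorov_dist l (distr M borel X) (distr M borel Y)"

end

theory Submission
  imports Defs
begin

text \<open>
  Stein's method. A Borel set \<open>A\<close> is replaced by the tent function \<open>h\<close> that is \<open>1\<close> on \<open>A\<close>, vanishes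
  off the \<open>\<delta>\<close>-enlargement and is \<open>1/\<delta>\<close>-Lipschitz, where \<open>\<delta> = \<lambda> \<alpha>\<close>. The Stein equation
  \<open>f' x - x f x = h x - E h(\<xi>)\<close> has a solution with \<open>f\<close> bounded and \<open>\<bar>f'\<bar> \<le> 2\<close>, and then
  \<open>E h(S) - E h(\<xi>) = E [f' S - S f S]\<close>. Splitting off one summand \<open>X\<close> as \<open>S = W + X\<close>,
  independence leaves only the first-order Taylor remainder of \<open>f\<close> at \<open>W\<close>: where \<open>\<bar>X\<bar> > \<epsilon>\<close> it is
  bounded through the oscillation \<open>4\<close> of \<open>f'\<close>, which is the source of the constant \<open>4\<close>. Where
  \<open>\<bar>X\<bar> \<le> \<epsilon>\<close> the modulus of continuity of \<open>f'\<close>, which depends on \<open>A\<close> only through \<open>\<delta>\<close>, gives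
  an \<open>O(\<epsilon>)\<close> contribution. The cost of replacing \<open>f' W\<close> by \<open>f' S\<close> is controlled by Feller's
  condition.
\<close>

section \<open>The Stein equation for the standard normal distribution\<close>

lemma DERIV_std_normal_density:
  "(std_normal_density has_real_derivative - (x * std_normal_density x)) (at x)"
  unfolding std_normal_density_def[abs_def]
  by (auto intro!: derivative_eq_intros simp: field_simps)

lemma std_normal_density_le_1: "std_normal_density x \<le> 1"
proof -
  have "1 * 1 \<le> 2 * pi" using pi_gt3 by simp
  then have "1 \<le> sqrt (2 * pi)" by (metis mult_1 real_sqrt_ge_1_iff)
  then have "(1 / sqrt (2 * pi)) * exp (- x\<^sup>2 / 2) \<le> 1 * 1"
    by (intro mult_mono) (auto simp: divide_le_eq)
  then show ?thesis by (simp add: std_normal_density_def)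
qed

lemma std_normal_density_antimono:
  assumes "\<bar>x\<bar> \<le> \<bar>y\<bar>"
  shows "std_normal_density y \<le> std_normal_density x"
  using assms by (auto simp: std_normal_density_def divide_right_mono abs_le_square_iff)

lemma std_normal_density_tendsto_0: "(std_normal_density \<longlongrightarrow> 0) at_top"
proof -
  have "((\<lambda>x::real. (1 / sqrt (2 * pi)) * exp (- x\<^sup>2 / 2)) \<longlongrightarrow> (1 / sqrt (2 * pi)) * 0) at_top"
    by (intro tendsto_intros filterlim_compose[OF exp_at_bot])
       (auto simp: power2_eq_square filterlim_uminus_at_bot
          intro!: filterlim_at_top_mult_at_top filterlim_ident
            filterlim_tendsto_pos_mult_at_top[OF tendsto_const, of "1/2", simplified])
  then show ?thesis by (simp add: std_normal_density_def[abs_def])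
qed

lemma integrable_std_normal_indicator:
  assumes [measurable]: "A \<in> sets borel"
  shows "integrable lborel (\<lambda>t. indicator A t * std_normal_density t)"
  by (rule Bochner_Integration.integrable_bound[of _ std_normal_density])
     (auto simp: indicator_def)

text \<open>The negative of the density is an antiderivative of
  \<open>t * std_normal_density t\<close> and vanishes at infinity. For \<open>0 \<le> x\<close> the
  integrand is nonnegative on \<open>{x..}\<close>, so integrability and value both follow from the
  nonnegative integral.\<close>

lemma std_normal_first_moment_tail:
  assumes "0 \<le> x"
  shows "has_bochner_integral lborel (\<lambda>t. indicator {x..} t * (t * std_normal_density t))
           (std_normal_density x)"
proof (rule has_bochner_integral_nn_integral)
  have "(\<integral>\<^sup>+t. ennreal (t * std_normal_density t) * indicator {x..} t \<partial>lborel)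
      = 0 - (- std_normal_density x)"
  proof (rule nn_integral_FTC_atLeast[where F = "\<lambda>t. - std_normal_density t"])
    show "((\<lambda>t. - std_normal_density t) \<longlongrightarrow> 0) at_top"
      using tendsto_minus[OF std_normal_density_tendsto_0] by simp
    show "((\<lambda>t. - std_normal_density t) has_real_derivative t * std_normal_density t) (at t)" for t
      using DERIV_minus[OF DERIV_std_normal_density[of t]] by simp
  qed (use assms in auto)
  moreover have "(\<integral>\<^sup>+t. ennreal (indicator {x..} t * (t * std_normal_density t)) \<partial>lborel)
      = (\<integral>\<^sup>+t. ennreal (t * std_normal_density t) * indicator {x..} t \<partial>lborel)"
    by (intro nn_integral_cong) (auto simp: indicator_def)
  ultimately show "(\<integral>\<^sup>+t. ennreal (indicator {x..} t * (t * std_normal_density t)) \<partial>lborel)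
      = ennreal (std_normal_density x)" by simp
qed (use assms in \<open>auto simp: indicator_def\<close>)

definition std_normal_tail :: "real \<Rightarrow> real" where
  "std_normal_tail x = (\<integral>t. indicator {x..} t * std_normal_density t \<partial>lborel)"

lemma std_normal_tail_nonneg: "0 \<le> std_normal_tail x"
  unfolding std_normal_tail_def by (intro integral_nonneg_AE) auto

lemma std_normal_tail_le_1: "std_normal_tail x \<le> 1"
proof -
  have "std_normal_tail x \<le> (\<integral>t. std_normal_density t \<partial>lborel)"
    unfolding std_normal_tail_def
    by (intro integral_mono integrable_std_normal_indicator) (auto simp: indicator_def)
  then show ?thesis by simp
qed

text \<open>Mills' ratio bound: \<open>x \<le> t\<close> on the domain of integration, so the
  truncated first moment dominates. This is what later gives
  \<open>\<bar>x * f x\<bar> \<le> 1\<close> for the Stein solution.\<close>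

lemma mult_std_normal_tail_le:
  assumes "0 \<le> x"
  shows "x * std_normal_tail x \<le> std_normal_density x"
proof -
  note tail = std_normal_first_moment_tail[OF assms]
  have "x * std_normal_tail x = (\<integral>t. x * (indicator {x..} t * std_normal_density t) \<partial>lborel)"
    unfolding std_normal_tail_def by simp
  also have "\<dots> \<le> (\<integral>t. indicator {x..} t * (t * std_normal_density t) \<partial>lborel)"
    using has_bochner_integral_integrable tail
    by (intro integral_mono integrable_mult_right integrable_std_normal_indicator)
       (auto simp: indicator_def mult_right_mono has_bochner_integral_iff)
  also have "\<dots> = std_normal_density x"
    using tail by (rule has_bochner_integral_integral_eq)
  finally show ?thesis .
qed

text \<open>Mills' bound degenerates at 0, hence the split at 1. Below 1 the tail is at most 1 and
  the density at least its value at 1; above 1 the factor \<open>x\<close> in Mills' bound may be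
  dropped. The constant only has to be finite: it will multiply terms that can be made
  small.\<close>

lemma std_normal_tail_le:
  assumes "0 \<le> x"
  shows "std_normal_tail x \<le> std_normal_density x / std_normal_density 1"
proof (cases "x \<le> 1")
  case True
  have "std_normal_density 1 \<le> std_normal_density x"
    using assms True by (intro std_normal_density_antimono) auto
  then show ?thesis
    using std_normal_tail_le_1[of x] by (simp add: le_divide_eq normal_density_pos)
      (smt (verit) mult_left_le_one_le normal_density_nonneg std_normal_tail_nonneg)
next
  case False
  have "std_normal_tail x \<le> x * std_normal_tail x"
    using False std_normal_tail_nonneg[of x] by (simp add: mult_le_cancel_right1)
  also have "\<dots> \<le> std_normal_density x" by (rule mult_std_normal_tail_le[OF assms])
  also have "\<dots> \<le> std_normal_density x / std_normal_density 1"
    using std_normal_density_le_1[of 1]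
    by (simp add: le_divide_eq normal_density_pos mult_left_le)
  finally show ?thesis .
qed

lemma std_normal_lower_tail:
  "(\<integral>t. indicator {..x} t * std_normal_density t \<partial>lborel) = std_normal_tail (- x)"
proof -
  have "(\<integral>t. indicator {..x} t * std_normal_density t \<partial>lborel)
      = (\<integral>t. indicator {..x} (- t) * std_normal_density (- t) \<partial>lborel)"
    using lborel_integral_real_affine[of "-1" "\<lambda>t. indicator {..x} t * std_normal_density t" 0]
    by simp
  also have "\<dots> = std_normal_tail (- x)"
    unfolding std_normal_tail_def
    by (intro Bochner_Integration.integral_cong) (auto simp: indicator_def std_normal_density_def)
  finally show ?thesis .
qed

section \<open>Bounded solution of the Stein equation\<close>

text \<open>Since \<open>q\<close> has total integral 0, its integrals over the two half-lines at
  \<open>x\<close> differ only in sign. The half-line pointing away from the origin is the one to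
  estimate; its Gaussian mass is the tail at \<open>\<bar>x\<bar>\<close>.\<close>

lemma stein_primitive_bound:
  fixes q :: "real \<Rightarrow> real"
  assumes int: "integrable lborel q"
    and mean: "(\<integral>t. q t \<partial>lborel) = 0"
    and bound: "\<And>t. \<bar>q t\<bar> \<le> std_normal_density t"
  shows "\<bar>\<integral>t. indicator {..x} t * q t \<partial>lborel\<bar> \<le> std_normal_tail \<bar>x\<bar>"
proof -
  have int_ind: "integrable lborel (\<lambda>t. indicator A t * q t)" if "A \<in> sets borel" for A
    using integrable_real_mult_indicator[of A lborel q] that int by (simp add: mult.commute)
  have dom: "\<bar>\<integral>t. indicator A t * q t \<partial>lborel\<bar>
      \<le> (\<integral>t. indicator A t * std_normal_density t \<partial>lborel)" if A: "A \<in> sets borel" for A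
    using integrable_std_normal_indicator[OF A] int_ind[OF A] bound
    by (intro integral_abs_bound[THEN order_trans] integral_mono) (auto simp: indicator_def)
  show ?thesis
  proof (cases "0 \<le> x")
    case True
    have "(\<integral>t. indicator {..x} t * q t \<partial>lborel) + (\<integral>t. indicator {x<..} t * q t \<partial>lborel)
        = (\<integral>t. indicator {..x} t * q t + indicator {x<..} t * q t \<partial>lborel)"
      by (intro Bochner_Integration.integral_add[symmetric] int_ind) auto
    also have "\<dots> = (\<integral>t. q t \<partial>lborel)"
      by (intro Bochner_Integration.integral_cong) (auto simp: indicator_def)
    finally have "\<bar>\<integral>t. indicator {..x} t * q t \<partial>lborel\<bar>
        = \<bar>\<integral>t. indicator {x<..} t * q t \<partial>lborel\<bar>" using mean by simp
    also have "\<dots> \<le> (\<integral>t. indicator {x<..} t * std_normal_density t \<partial>lborel)"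
      by (rule dom) auto
    also have "\<dots> \<le> std_normal_tail x" unfolding std_normal_tail_def
      by (intro integral_mono integrable_std_normal_indicator) (auto simp: indicator_def)
    finally show ?thesis using True by simp
  next
    case False
    then show ?thesis using dom[of "{..x}"] by (simp add: std_normal_lower_tail)
  qed
qed

text \<open>The mass left of \<open>x - 1\<close> is a constant, so near \<open>x\<close> the
  function differs by a constant from an integral over a compact interval with \<open>x\<close> in
  the interior of its range, where the fundamental theorem of calculus applies.\<close>

lemma DERIV_integral_atMost:
  fixes q :: "real \<Rightarrow> real"
  assumes int: "integrable lborel q" and cont: "continuous_on UNIV q"
  shows "((\<lambda>x. \<integral>t. indicator {..x} t * q t \<partial>lborel) has_real_derivative q x) (at x)"
proof -
  let ?G = "\<lambda>x. \<integral>t. indicator {..x} t * q t \<partial>lborel"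
  have int_ind: "integrable lborel (\<lambda>t. indicator A t * q t)" if "A \<in> sets borel" for A
    using integrable_real_mult_indicator[of A lborel q] that int by (simp add: mult.commute)
  have split: "?G y = (\<integral>t. indicator {..<x-1} t * q t \<partial>lborel) + integral {x-1..y} q"
    if "x - 1 \<le> y" for y
  proof -
    have "?G y = (\<integral>t. indicator {..<x-1} t * q t + indicator {x-1..y} t * q t \<partial>lborel)"
      using that by (intro Bochner_Integration.integral_cong) (auto simp: indicator_def)
    also have "\<dots> = (\<integral>t. indicator {..<x-1} t * q t \<partial>lborel)
        + (\<integral>t. indicator {x-1..y} t * q t \<partial>lborel)"
      by (intro Bochner_Integration.integral_add int_ind) auto
    also have "(\<integral>t. indicator {x-1..y} t * q t \<partial>lborel) = integral {x-1..y} q"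
      using set_borel_integral_eq_integral(2)[of "{x-1..y}" q] int_ind[of "{x-1..y}"]
      by (simp add: set_integrable_def set_lebesgue_integral_def)
    finally show ?thesis .
  qed
  have "((\<lambda>y. integral {x-1..y} q) has_real_derivative q x) (at x within {x-1..x+1})"
    by (rule integral_has_real_derivative) (auto intro: continuous_on_subset[OF cont])
  then have "((\<lambda>y. integral {x-1..y} q) has_real_derivative q x) (at x)"
    by (simp add: at_within_Icc_at)
  then have "((\<lambda>y. (\<integral>t. indicator {..<x-1} t * q t \<partial>lborel) + integral {x-1..y} q)
      has_real_derivative q x) (at x)"
    by (auto intro!: derivative_eq_intros)
  then show ?thesis
    by (rule has_field_derivative_transform_within_open[of _ _ _ "{x-1<..}"])
       (auto simp: split)
qed

lemma stein_equation_solution: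
  fixes h :: "real \<Rightarrow> real"
  assumes cont: "continuous_on UNIV h" and h01: "\<And>x. 0 \<le> h x" "\<And>x. h x \<le> 1"
  obtains f f' :: "real \<Rightarrow> real"
  where "\<And>x. (f has_real_derivative f' x) (at x)"
    and "\<And>x. f' x - x * f x = h x - (\<integral>t. std_normal_density t * h t \<partial>lborel)"
    and "\<And>x. \<bar>f x\<bar> \<le> 1 / std_normal_density 1"
    and "\<And>x. \<bar>f' x\<bar> \<le> 2"
proof -
  let ?\<phi> = std_normal_density
  define m where "m = (\<integral>t. ?\<phi> t * h t \<partial>lborel)"
  define q where "q t = ?\<phi> t * (h t - m)" for t
  define G where "G x = (\<integral>t. indicator {..x} t * q t \<partial>lborel)" for x
  have [measurable]: "h \<in> borel_measurable borel"
    using cont by (rule borel_measurable_continuous_onI)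
  have int_h: "integrable lborel (\<lambda>t. ?\<phi> t * h t)"
  proof (rule Bochner_Integration.integrable_bound[of _ ?\<phi>])
    show "AE t in lborel. norm (?\<phi> t * h t) \<le> norm (?\<phi> t)"
      using h01 by (intro AE_I2) (simp add: abs_mult mult_left_le)
  qed simp_all
  have "0 \<le> m" unfolding m_def using h01 by (intro integral_nonneg_AE) auto
  have "m \<le> (\<integral>t. ?\<phi> t \<partial>lborel)" unfolding m_def
    by (intro integral_mono int_h) (simp_all add: mult_left_le h01(2))
  then have "m \<le> 1" by simp
  have hm: "\<bar>h x - m\<bar> \<le> 1" for x
    using h01[of x] \<open>0 \<le> m\<close> \<open>m \<le> 1\<close> by linarith
  have q_eq: "q = (\<lambda>t. ?\<phi> t * h t - m * ?\<phi> t)"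
    by (auto simp: q_def fun_eq_iff algebra_simps)
  have int_q: "integrable lborel q" unfolding q_eq using int_h by simp
  have mean_q: "(\<integral>t. q t \<partial>lborel) = 0" unfolding q_eq
    using int_h by (simp add: m_def)
  have bound_q: "\<bar>q t\<bar> \<le> ?\<phi> t" for t
    using hm[of t] by (simp add: q_def abs_mult mult_left_le)
  have "continuous_on UNIV ?\<phi>" unfolding std_normal_density_def[abs_def]
    by (intro continuous_intros) auto
  then have cont_q: "continuous_on UNIV q" unfolding q_def
    by (intro continuous_intros cont)
  have DG: "(G has_real_derivative q x) (at x)" for x
    unfolding G_def[abs_def] by (rule DERIV_integral_atMost[OF int_q cont_q])
  have G: "\<bar>G x\<bar> \<le> std_normal_tail \<bar>x\<bar>" for x
    unfolding G_def by (rule stein_primitive_bound[OF int_q mean_q bound_q])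
  have pos: "0 < ?\<phi> x" for x by (simp add: normal_density_pos)
  have abs: "?\<phi> \<bar>x\<bar> = ?\<phi> x" for x by (simp add: std_normal_density_def)
  \<comment> \<open>The density is, up to a constant, the reciprocal of the integrating factor of
    the linear equation. Integrating from minus infinity selects the bounded solution.\<close>
  define f where "f x = G x / ?\<phi> x" for x
  \<comment> \<open>Read off from the Stein equation, which thereby holds by definition; what
    remains to be proved is that this is the derivative of \<open>f\<close>.\<close>
  define f' where "f' x = x * f x + (h x - m)" for x
  have "(f has_real_derivative f' x) (at x)" for x
  proof -
    have "(f has_real_derivative (q x * ?\<phi> x - G x * - (x * ?\<phi> x)) / (?\<phi> x * ?\<phi> x)) (at x)"
      unfolding f_def[abs_def] using pos[of x]
      by (intro DERIV_divide DG DERIV_std_normal_density) auto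
    also have "(q x * ?\<phi> x - G x * - (x * ?\<phi> x)) / (?\<phi> x * ?\<phi> x) = f' x"
      using pos[of x] by (simp add: f'_def f_def q_def field_simps)
    finally show ?thesis .
  qed
  moreover have "f' x - x * f x = h x - m" for x by (simp add: f'_def)
  moreover have "\<bar>f x\<bar> \<le> 1 / ?\<phi> 1" for x
  proof -
    have "\<bar>G x\<bar> \<le> ?\<phi> x / ?\<phi> 1" using G[of x] std_normal_tail_le[of "\<bar>x\<bar>"] by (simp add: abs)
    then show ?thesis using pos[of x] by (simp add: f_def divide_le_eq mult.commute)
  qed
  moreover have "\<bar>f' x\<bar> \<le> 2" for x
  proof -
    \<comment> \<open>Mills' bound yields \<open>\<bar>x * f x\<bar> \<le> 1\<close>; the other
      summand of \<open>f' x\<close> is \<open>h x - m\<close>, also at most 1 in absolute value.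
      Hence the bound 2.\<close>
    have "\<bar>x\<bar> * \<bar>G x\<bar> \<le> \<bar>x\<bar> * std_normal_tail \<bar>x\<bar>" by (intro mult_left_mono G) auto
    also have "\<dots> \<le> ?\<phi> x" using mult_std_normal_tail_le[of "\<bar>x\<bar>"] by (simp add: abs)
    finally have "\<bar>x * f x\<bar> \<le> 1" using pos[of x] by (simp add: f_def abs_mult divide_le_eq)
    then show ?thesis using hm[of x] unfolding f'_def by linarith
  qed
  ultimately show ?thesis using that unfolding m_def by blast
qed

text \<open>
  A modulus growing linearly in \<open>x\<close> avoids estimating \<open>f''\<close>; it suffices because the partial sums
  have bounded first absolute moments.
\<close>

lemma stein_derivative_modulus:
  fixes f f' h :: "real \<Rightarrow> real"
  assumes D: "\<And>x. (f has_real_derivative f' x) (at x)"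
    and eq: "\<And>x. f' x - x * f x = h x - m"
    and B: "\<And>x. \<bar>f x\<bar> \<le> B" and D2: "\<And>x. \<bar>f' x\<bar> \<le> d"
    and L: "\<And>x y. \<bar>h x - h y\<bar> \<le> L * \<bar>x - y\<bar>"
  shows "\<bar>f' x - f' y\<bar> \<le> (L + B + d * \<bar>x\<bar>) * \<bar>x - y\<bar>"
proof -
  have "norm (f x - f y) \<le> d * norm (x - y)"
    using D D2 by (intro field_differentiable_bound[of UNIV f f']) auto
  then have "\<bar>x * (f x - f y)\<bar> \<le> \<bar>x\<bar> * (d * \<bar>x - y\<bar>)"
    by (simp add: abs_mult mult_left_mono)
  moreover have "\<bar>(x - y) * f y\<bar> \<le> B * \<bar>x - y\<bar>"
    using B[of y] by (simp add: abs_mult mult.commute mult_right_mono)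
  \<comment> \<open>The difference of the Stein equations at the two points, in which
    \<open>m\<close> cancels. Writing \<open>x * f x - y * f y\<close> with the increment of
    \<open>f\<close> weighted by \<open>x\<close> makes the modulus depend on \<open>x\<close>
    alone.\<close>
  moreover have "f' x - f' y = x * (f x - f y) + (x - y) * f y + (h x - h y)"
    using eq[of x] eq[of y] by (simp add: algebra_simps)
  moreover have "(L + B + d * \<bar>x\<bar>) * \<bar>x - y\<bar> = L * \<bar>x - y\<bar> + B * \<bar>x - y\<bar> + \<bar>x\<bar> * (d * \<bar>x - y\<bar>)"
    by (simp add: algebra_simps)
  ultimately show ?thesis using L[of x y] by linarith
qed

section \<open>Sums of independent random variables\<close>

lemma integrable_mult_bounded:
  fixes X g :: "'a \<Rightarrow> real"
  assumes X: "integrable M X" and [measurable]: "g \<in> borel_measurable M" and g: "\<And>\<omega>. \<bar>g \<omega>\<bar> \<le> B"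
  shows "integrable M (\<lambda>\<omega>. X \<omega> * g \<omega>)"
proof (rule Bochner_Integration.integrable_bound)
  show "integrable M (\<lambda>\<omega>. X \<omega> * B)" using X by simp
  show "(\<lambda>\<omega>. X \<omega> * g \<omega>) \<in> borel_measurable M" using X by measurable
  show "AE \<omega> in M. norm (X \<omega> * g \<omega>) \<le> norm (X \<omega> * B)"
    using g[THEN order_trans, OF abs_ge_self] by (simp add: abs_mult mult_left_mono)
qed

lemma (in prob_space) indep_var_expectation_mult:
  fixes u v :: "real \<Rightarrow> real"
  assumes indep: "indep_var borel X borel Y"
    and [measurable]: "u \<in> borel_measurable borel" "v \<in> borel_measurable borel"
    and "integrable M (\<lambda>\<omega>. u (X \<omega>))" "integrable M (\<lambda>\<omega>. v (Y \<omega>))"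
  shows "integrable M (\<lambda>\<omega>. u (X \<omega>) * v (Y \<omega>))"
    and "expectation (\<lambda>\<omega>. u (X \<omega>) * v (Y \<omega>))
           = expectation (\<lambda>\<omega>. u (X \<omega>)) * expectation (\<lambda>\<omega>. v (Y \<omega>))"
proof -
  have "indep_var borel (u \<circ> X) borel (v \<circ> Y)"
    by (rule indep_var_compose[OF indep]) auto
  from indep_var_integrable[OF this] indep_var_lebesgue_integral[OF this] assms(4,5)
  show "integrable M (\<lambda>\<omega>. u (X \<omega>) * v (Y \<omega>))"
    and "expectation (\<lambda>\<omega>. u (X \<omega>) * v (Y \<omega>))
           = expectation (\<lambda>\<omega>. u (X \<omega>)) * expectation (\<lambda>\<omega>. v (Y \<omega>))"
    by (auto simp: comp_def)
qed

text \<open>Adding one summand produces a cross term whose expectation factors by independence and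
  vanishes by centring. The conjunction lets the induction carry integrability along with the
  value.\<close>

lemma (in prob_space) indep_vars_sum_second_moment:
  fixes X :: "'i \<Rightarrow> 'a \<Rightarrow> real"
  assumes "finite I" "indep_vars (\<lambda>_. borel) X I"
    and "\<And>i. i \<in> I \<Longrightarrow> integrable M (\<lambda>\<omega>. (X i \<omega>)\<^sup>2)"
    and "\<And>i. i \<in> I \<Longrightarrow> expectation (X i) = 0"
  shows "integrable M (\<lambda>\<omega>. (\<Sum>i\<in>I. X i \<omega>)\<^sup>2) \<and>
         expectation (\<lambda>\<omega>. (\<Sum>i\<in>I. X i \<omega>)\<^sup>2) = (\<Sum>i\<in>I. expectation (\<lambda>\<omega>. (X i \<omega>)\<^sup>2))"
  using assms
proof (induction I rule: finite_induct)
  case (insert i I)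
  let ?S = "\<lambda>\<omega>. \<Sum>j\<in>I. X j \<omega>"
  have "indep_vars (\<lambda>_. borel) X I"
    using insert.prems(1) by (rule indep_vars_subset) auto
  then have IH: "integrable M (\<lambda>\<omega>. (?S \<omega>)\<^sup>2)"
      "expectation (\<lambda>\<omega>. (?S \<omega>)\<^sup>2) = (\<Sum>i\<in>I. expectation (\<lambda>\<omega>. (X i \<omega>)\<^sup>2))"
    using insert.IH insert.prems by auto
  have indep: "indep_var borel (X i) borel ?S"
    using insert.hyps insert.prems(1) by (intro indep_vars_sum) auto
  have [measurable]: "X i \<in> borel_measurable M" "?S \<in> borel_measurable M"
    using indep by (blast dest: indep_var_rv1 indep_var_rv2)+
  have X2: "integrable M (\<lambda>\<omega>. (X i \<omega>)\<^sup>2)" and "expectation (X i) = 0"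
    using insert.prems by auto
  moreover have "integrable M (X i)" "integrable M ?S"
    using X2 IH by (auto intro: square_integrable_imp_integrable)
  ultimately have cross: "integrable M (\<lambda>\<omega>. X i \<omega> * ?S \<omega>)"
      "expectation (\<lambda>\<omega>. X i \<omega> * ?S \<omega>) = 0"
    using indep_var_expectation_mult[OF indep, of "\<lambda>x. x" "\<lambda>x. x"] by auto
  have "(\<lambda>\<omega>. (\<Sum>j\<in>insert i I. X j \<omega>)\<^sup>2) = (\<lambda>\<omega>. (X i \<omega>)\<^sup>2 + 2 * (X i \<omega> * ?S \<omega>) + (?S \<omega>)\<^sup>2)"
    using insert.hyps by (auto simp: power2_eq_square algebra_simps)
  then show ?case using insert.hyps X2 IH cross by simp
qed simp

text \<open>Integrates the pointwise inequality
  \<open>\<bar>x\<bar> \<le> e + x\<^sup>2 / e\<close>. The free parameter serves two purposes: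
  \<open>e = 1\<close> bounds the first moment of a partial sum, and the truncation level bounds
  that of a single small summand.\<close>

lemma (in prob_space) abs_moment_le:
  assumes [measurable]: "random_variable borel X"
    and "integrable M (\<lambda>\<omega>. (X \<omega>)\<^sup>2)" and e: "(0::real) < e"
  shows "integrable M (\<lambda>\<omega>. \<bar>X \<omega>\<bar>)"
    and "expectation (\<lambda>\<omega>. \<bar>X \<omega>\<bar>) \<le> e + expectation (\<lambda>\<omega>. (X \<omega>)\<^sup>2) / e"
proof -
  show int: "integrable M (\<lambda>\<omega>. \<bar>X \<omega>\<bar>)"
    using assms by (auto intro: square_integrable_imp_integrable)
  have "\<bar>x\<bar> \<le> e + x\<^sup>2 / e" for x
  proof -
    have "0 \<le> (\<bar>x\<bar> - e)\<^sup>2 + \<bar>x\<bar> * e" using e by simp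
    then have "\<bar>x\<bar> * e \<le> e * e + x\<^sup>2" by (simp add: power2_eq_square algebra_simps)
    then show ?thesis using e by (simp add: field_simps)
  qed
  then have "expectation (\<lambda>\<omega>. \<bar>X \<omega>\<bar>) \<le> expectation (\<lambda>\<omega>. e + (X \<omega>)\<^sup>2 / e)"
    using assms int by (intro integral_mono) auto
  then show "expectation (\<lambda>\<omega>. \<bar>X \<omega>\<bar>) \<le> e + expectation (\<lambda>\<omega>. (X \<omega>)\<^sup>2) / e"
    using assms by (simp add: prob_space)
qed

section \<open>Leave-one-out estimates for the Stein identity\<close>

text \<open>By the mean value theorem the remainder is \<open>x * (f' z - f' w)\<close> with
  \<open>z\<close> within \<open>\<bar>x\<bar>\<close> of \<open>w\<close>. For large
  \<open>\<bar>x\<bar>\<close> the difference is bounded by the oscillation \<open>2 * d\<close>,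
  for small \<open>\<bar>x\<bar>\<close> by the modulus of continuity.\<close>

lemma first_order_remainder_bound:
  fixes f f' :: "real \<Rightarrow> real"
  assumes D: "\<And>x. (f has_real_derivative f' x) (at x)"
    and d: "\<And>x. \<bar>f' x\<bar> \<le> d"
    and modulus: "\<And>x y. \<bar>f' x - f' y\<bar> \<le> c x * \<bar>x - y\<bar>"
    and c: "\<And>x. 0 \<le> c x" and e: "0 \<le> e"
  shows "\<bar>f (w + x) - f w - x * f' w\<bar> \<le> \<bar>x\<bar> * (2 * d * indicator {x. e < \<bar>x\<bar>} x + e * c w)"
proof -
  obtain z where z: "\<bar>w - z\<bar> \<le> \<bar>x\<bar>" "f (w + x) - f w = x * f' z"
  proof -
    consider "x = 0" | "0 < x" | "x < 0" by linarith
    then show thesis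
    proof cases
      case 2
      then obtain z where "w < z" "z < w + x" "f (w + x) - f w = (w + x - w) * f' z"
        using MVT2[of w "w + x" f f'] D by auto
      then show thesis using that[of z] by auto
    next
      case 3
      then obtain z where "w + x < z" "z < w" "f w - f (w + x) = (w - (w + x)) * f' z"
        using MVT2[of "w + x" w f f'] D by auto
      then show thesis using that[of z] by auto
    qed (use that[of w] in auto)
  qed
  have "\<bar>f' z - f' w\<bar> \<le> 2 * d * indicator {x. e < \<bar>x\<bar>} x + e * c w"
  proof (cases "e < \<bar>x\<bar>")
    case True
    then show ?thesis using d[of z] d[of w] mult_nonneg_nonneg[OF e c[of w]] by auto
  next
    case False
    \<comment> \<open>The modulus is anchored at \<open>w\<close> and not at \<open>z\<close>, so
      that the factor \<open>c w\<close> will be independent of the summand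
      \<open>x\<close>.\<close>
    have "\<bar>f' w - f' z\<bar> \<le> c w * e"
      using z False c[of w] by (intro modulus[THEN order_trans] mult_left_mono) auto
    then show ?thesis using False by (simp add: mult.commute abs_minus_commute)
  qed
  moreover have "f (w + x) - f w - x * f' w = x * (f' z - f' w)"
    using z by (simp add: algebra_simps)
  ultimately show ?thesis by (simp add: abs_mult mult_left_mono)
qed

text \<open>Expands \<open>X * f (W + X)\<close> at \<open>W\<close>. By independence the
  zeroth-order term has mean 0 and the first-order term factors into the variance of
  \<open>X\<close> times the mean of \<open>f' W\<close>. Two errors remain: the Taylor remainder,
  and the cost of replacing \<open>f' W\<close> by \<open>f' (W + X)\<close>.\<close>

lemma (in prob_space) stein_summand_bound:
  fixes f f' :: "real \<Rightarrow> real" and X W :: "'a \<Rightarrow> real"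
  assumes indep: "indep_var borel X borel W"
    and X2: "integrable M (\<lambda>\<omega>. (X \<omega>)\<^sup>2)" and EX: "expectation X = 0"
    and W2: "integrable M (\<lambda>\<omega>. (W \<omega>)\<^sup>2)" and EW: "expectation (\<lambda>\<omega>. (W \<omega>)\<^sup>2) \<le> 1"
    and D: "\<And>x. (f has_real_derivative f' x) (at x)"
    and [measurable]: "f' \<in> borel_measurable borel"
    and B: "\<And>x. \<bar>f x\<bar> \<le> B" and d: "\<And>x. \<bar>f' x\<bar> \<le> d"
    and modulus: "\<And>x y. \<bar>f' x - f' y\<bar> \<le> (a + d * \<bar>x\<bar>) * \<bar>x - y\<bar>"
    and a: "0 \<le> a" and e: "0 < e"
  shows "\<bar>expectation (\<lambda>\<omega>. X \<omega> * f (W \<omega> + X \<omega>))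
           - expectation (\<lambda>\<omega>. (X \<omega>)\<^sup>2) * expectation (\<lambda>\<omega>. f' (W \<omega> + X \<omega>))\<bar>
         \<le> 2 * d * (LINT \<omega>:{\<omega>\<in>space M. \<bar>X \<omega>\<bar> > e}|M. (X \<omega>)\<^sup>2)
           + expectation (\<lambda>\<omega>. (X \<omega>)\<^sup>2) * ((a + 2 * d) * (2 * e + expectation (\<lambda>\<omega>. (X \<omega>)\<^sup>2) / e))"
proof -
  define s where "s = expectation (\<lambda>\<omega>. (X \<omega>)\<^sup>2)"
  define c where "c x = a + d * \<bar>x\<bar>" for x :: real
  have [measurable]: "X \<in> borel_measurable M" "W \<in> borel_measurable M"
    using indep by (blast dest: indep_var_rv1 indep_var_rv2)+
  have "continuous_on UNIV f" using D by (meson DERIV_isCont continuous_at_imp_continuous_on)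
  then have [measurable]: "f \<in> borel_measurable borel" by (rule borel_measurable_continuous_onI)
  have [measurable]: "c \<in> borel_measurable borel" unfolding c_def by measurable
  have "0 \<le> d" using d[of 0] by linarith
  then have c_nonneg: "0 \<le> c x" for x using a by (simp add: c_def)
  have "0 \<le> s" unfolding s_def by simp
  have bnd: "integrable M (\<lambda>\<omega>. g (U \<omega>))"
    if [measurable]: "g \<in> borel_measurable borel" "U \<in> borel_measurable M"
      and "\<And>x. \<bar>g x\<bar> \<le> K" for g :: "real \<Rightarrow> real" and U :: "'a \<Rightarrow> real" and K
    using that by (intro integrable_const_bound[of _ K]) auto
  have intX: "integrable M X" using X2 by (auto intro: square_integrable_imp_integrable)
  have int_cW: "integrable M (\<lambda>\<omega>. c (W \<omega>))"
    unfolding c_def using abs_moment_le(1)[OF _ W2, of 1] by simp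
  have "expectation (\<lambda>\<omega>. \<bar>W \<omega>\<bar>) \<le> 2"
    using abs_moment_le(2)[OF _ W2, of 1] EW by simp
  then have "d * expectation (\<lambda>\<omega>. \<bar>W \<omega>\<bar>) \<le> d * 2"
    using \<open>0 \<le> d\<close> by (rule mult_left_mono)
  \<comment> \<open>The linear growth of the modulus is harmless here: \<open>W\<close> has second
    moment at most 1, hence first absolute moment at most 2.\<close>
  then have EcW: "expectation (\<lambda>\<omega>. c (W \<omega>)) \<le> a + 2 * d"
    unfolding c_def using abs_moment_le(1)[OF _ W2, of 1] by (simp add: prob_space mult.commute)
  have EcW_nonneg: "0 \<le> expectation (\<lambda>\<omega>. c (W \<omega>))" using c_nonneg by simp
  define R where "R \<omega> = X \<omega> * (f (W \<omega> + X \<omega>) - f (W \<omega>) - X \<omega> * f' (W \<omega>))" for \<omega>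
  define Ind :: "'a \<Rightarrow> real" where "Ind = indicator {\<omega>\<in>space M. e < \<bar>X \<omega>\<bar>}"
  have [measurable]: "Ind \<in> borel_measurable M" unfolding Ind_def by measurable
  have Xf: "integrable M (\<lambda>\<omega>. X \<omega> * f (W \<omega>))" "expectation (\<lambda>\<omega>. X \<omega> * f (W \<omega>)) = 0"
    using indep_var_expectation_mult[OF indep, of "\<lambda>x. x" f] intX bnd[of f W B] B EX by auto
  have X2f': "integrable M (\<lambda>\<omega>. (X \<omega>)\<^sup>2 * f' (W \<omega>))"
      "expectation (\<lambda>\<omega>. (X \<omega>)\<^sup>2 * f' (W \<omega>)) = s * expectation (\<lambda>\<omega>. f' (W \<omega>))"
    using indep_var_expectation_mult[OF indep, of "\<lambda>x. x\<^sup>2" f'] X2 bnd[of f' W d] d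
    by (auto simp: s_def)
  have X2c: "integrable M (\<lambda>\<omega>. (X \<omega>)\<^sup>2 * c (W \<omega>))"
      "expectation (\<lambda>\<omega>. (X \<omega>)\<^sup>2 * c (W \<omega>)) = s * expectation (\<lambda>\<omega>. c (W \<omega>))"
    using indep_var_expectation_mult[OF indep, of "\<lambda>x. x\<^sup>2" c] X2 int_cW by (auto simp: s_def)
  have Xc: "integrable M (\<lambda>\<omega>. \<bar>X \<omega>\<bar> * c (W \<omega>))"
      "expectation (\<lambda>\<omega>. \<bar>X \<omega>\<bar> * c (W \<omega>))
         = expectation (\<lambda>\<omega>. \<bar>X \<omega>\<bar>) * expectation (\<lambda>\<omega>. c (W \<omega>))"
    using indep_var_expectation_mult[OF indep, of abs c] intX int_cW by auto
  have X2I: "integrable M (\<lambda>\<omega>. (X \<omega>)\<^sup>2 * Ind \<omega>)"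
    by (rule Bochner_Integration.integrable_bound[OF X2]) (auto simp: Ind_def indicator_def)
  have int_f'S: "integrable M (\<lambda>\<omega>. f' (W \<omega> + X \<omega>))" and int_f'W: "integrable M (\<lambda>\<omega>. f' (W \<omega>))"
    using bnd[of f' _ d] d by auto
  have int_XfS: "integrable M (\<lambda>\<omega>. X \<omega> * f (W \<omega> + X \<omega>))"
    by (rule integrable_mult_bounded[OF intX _ B]) measurable
  have int_R: "integrable M R"
  proof -
    have "R = (\<lambda>\<omega>. X \<omega> * f (W \<omega> + X \<omega>) - X \<omega> * f (W \<omega>) - (X \<omega>)\<^sup>2 * f' (W \<omega>))"
      by (auto simp: R_def power2_eq_square algebra_simps)
    then show ?thesis using int_XfS Xf X2f' by simp
  qed
  have "X \<omega> * f (W \<omega> + X \<omega>) = X \<omega> * f (W \<omega>) + (X \<omega>)\<^sup>2 * f' (W \<omega>) + R \<omega>" for \<omega>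
    by (simp add: R_def power2_eq_square algebra_simps)
  then have expand: "expectation (\<lambda>\<omega>. X \<omega> * f (W \<omega> + X \<omega>))
      = s * expectation (\<lambda>\<omega>. f' (W \<omega>)) + expectation R"
    using Xf X2f' int_R by simp
  have R_le: "\<bar>expectation R\<bar> \<le> 2 * d * expectation (\<lambda>\<omega>. (X \<omega>)\<^sup>2 * Ind \<omega>)
      + e * (s * expectation (\<lambda>\<omega>. c (W \<omega>)))"
  proof -
    have "\<bar>R \<omega>\<bar> \<le> 2 * d * ((X \<omega>)\<^sup>2 * Ind \<omega>) + e * ((X \<omega>)\<^sup>2 * c (W \<omega>))" if "\<omega> \<in> space M" for \<omega>
    proof -
      have "\<bar>R \<omega>\<bar> \<le> \<bar>X \<omega>\<bar> * (\<bar>X \<omega>\<bar> * (2 * d * Ind \<omega> + e * c (W \<omega>)))"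
        using first_order_remainder_bound[of f f' d c e "W \<omega>" "X \<omega>"] D d modulus c_nonneg e that
        unfolding R_def abs_mult
        by (intro mult_left_mono) (auto simp: c_def Ind_def indicator_def)
      also have "\<dots> = \<bar>X \<omega>\<bar>\<^sup>2 * (2 * d * Ind \<omega> + e * c (W \<omega>))"
        by (simp only: power2_eq_square mult.assoc)
      finally show ?thesis by (simp add: algebra_simps)
    qed
    then have "\<bar>expectation R\<bar>
        \<le> expectation (\<lambda>\<omega>. 2 * d * ((X \<omega>)\<^sup>2 * Ind \<omega>) + e * ((X \<omega>)\<^sup>2 * c (W \<omega>)))"
      using int_R X2I X2c by (intro integral_abs_bound[THEN order_trans] integral_mono) auto
    then show ?thesis using X2I X2c by simp
  qed
  \<comment> \<open>Anchoring at \<open>W\<close> again makes the bound a product of independent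
    factors.\<close>
  have shift_le: "\<bar>f' (W \<omega>) - f' (W \<omega> + X \<omega>)\<bar> \<le> \<bar>X \<omega>\<bar> * c (W \<omega>)" for \<omega>
    using modulus[of "W \<omega>" "W \<omega> + X \<omega>"] by (simp add: c_def mult.commute)
  have "\<bar>expectation (\<lambda>\<omega>. f' (W \<omega>)) - expectation (\<lambda>\<omega>. f' (W \<omega> + X \<omega>))\<bar>
      = \<bar>expectation (\<lambda>\<omega>. f' (W \<omega>) - f' (W \<omega> + X \<omega>))\<bar>"
    using int_f'W int_f'S by simp
  also have "\<dots> \<le> expectation (\<lambda>\<omega>. \<bar>X \<omega>\<bar> * c (W \<omega>))"
    by (intro integral_abs_bound[THEN order_trans] integral_mono integrable_abs
        Bochner_Integration.integrable_diff int_f'W int_f'S Xc(1) shift_le)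
  also have "\<dots> \<le> (e + s / e) * expectation (\<lambda>\<omega>. c (W \<omega>))"
    unfolding Xc s_def using abs_moment_le(2)[OF _ X2 e] EcW_nonneg by (intro mult_right_mono) auto
  finally have shift: "\<bar>expectation (\<lambda>\<omega>. f' (W \<omega>)) - expectation (\<lambda>\<omega>. f' (W \<omega> + X \<omega>))\<bar>
      \<le> (e + s / e) * expectation (\<lambda>\<omega>. c (W \<omega>))" .
  have lin: "expectation (\<lambda>\<omega>. (X \<omega>)\<^sup>2 * Ind \<omega>) = (LINT \<omega>:{\<omega>\<in>space M. \<bar>X \<omega>\<bar> > e}|M. (X \<omega>)\<^sup>2)"
    by (simp add: set_lebesgue_integral_def Ind_def mult.commute)
  have "\<bar>expectation (\<lambda>\<omega>. X \<omega> * f (W \<omega> + X \<omega>)) - s * expectation (\<lambda>\<omega>. f' (W \<omega> + X \<omega>))\<bar>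
      \<le> \<bar>expectation R\<bar> + s * \<bar>expectation (\<lambda>\<omega>. f' (W \<omega>)) - expectation (\<lambda>\<omega>. f' (W \<omega> + X \<omega>))\<bar>"
    unfolding expand using \<open>0 \<le> s\<close> abs_mult[of s "expectation (\<lambda>\<omega>. f' (W \<omega>)) - expectation (\<lambda>\<omega>. f' (W \<omega> + X \<omega>))"]
    by (simp add: right_diff_distrib)
  also have "\<dots> \<le> 2 * d * expectation (\<lambda>\<omega>. (X \<omega>)\<^sup>2 * Ind \<omega>)
      + e * (s * expectation (\<lambda>\<omega>. c (W \<omega>))) + s * ((e + s / e) * expectation (\<lambda>\<omega>. c (W \<omega>)))"
    by (intro add_mono R_le mult_left_mono shift \<open>0 \<le> s\<close>)
  \<comment> \<open>One \<open>e\<close> comes from the small-jump part of the remainder, and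
    \<open>e + s / e\<close> from the shift. Both carry the factor \<open>s\<close>, which allows
    summation over the array row.\<close>
  also have "\<dots> = 2 * d * expectation (\<lambda>\<omega>. (X \<omega>)\<^sup>2 * Ind \<omega>)
      + s * (expectation (\<lambda>\<omega>. c (W \<omega>)) * (2 * e + s / e))"
    by (simp add: algebra_simps)
  also have "\<dots> \<le> 2 * d * expectation (\<lambda>\<omega>. (X \<omega>)\<^sup>2 * Ind \<omega>)
      + s * ((a + 2 * d) * (2 * e + s / e))"
    using \<open>0 \<le> s\<close> e by (intro add_left_mono mult_left_mono mult_right_mono EcW) auto
  finally show ?thesis unfolding lin s_def .
qed

text \<open>The variances sum to 1, so the mean of \<open>f' S\<close> can be distributed over the
  summands with weights \<open>s i\<close> and compared term by term with \<open>X i * f S\<close>.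
  The same normalisation turns the sum of the errors \<open>s i * K\<close> into
  \<open>K\<close>.\<close>

lemma (in prob_space) stein_sum_bound:
  fixes f f' :: "real \<Rightarrow> real" and X :: "'i \<Rightarrow> 'a \<Rightarrow> real"
  assumes fin: "finite I" and indep: "indep_vars (\<lambda>_. borel) X I"
    and X2: "\<And>i. i \<in> I \<Longrightarrow> integrable M (\<lambda>\<omega>. (X i \<omega>)\<^sup>2)"
    and EX: "\<And>i. i \<in> I \<Longrightarrow> expectation (X i) = 0"
    and var: "(\<Sum>i\<in>I. expectation (\<lambda>\<omega>. (X i \<omega>)\<^sup>2)) = 1"
    and max: "\<And>i. i \<in> I \<Longrightarrow> expectation (\<lambda>\<omega>. (X i \<omega>)\<^sup>2) \<le> m"
    and D: "\<And>x. (f has_real_derivative f' x) (at x)"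
    and [measurable]: "f' \<in> borel_measurable borel"
    and B: "\<And>x. \<bar>f x\<bar> \<le> B" and d: "\<And>x. \<bar>f' x\<bar> \<le> d"
    and modulus: "\<And>x y. \<bar>f' x - f' y\<bar> \<le> (a + d * \<bar>x\<bar>) * \<bar>x - y\<bar>"
    and a: "0 \<le> a" and e: "0 < e"
  shows "\<bar>expectation (\<lambda>\<omega>. f' (\<Sum>i\<in>I. X i \<omega>) - (\<Sum>i\<in>I. X i \<omega>) * f (\<Sum>i\<in>I. X i \<omega>))\<bar>
         \<le> 2 * d * (\<Sum>i\<in>I. LINT \<omega>:{\<omega>\<in>space M. \<bar>X i \<omega>\<bar> > e}|M. (X i \<omega>)\<^sup>2)
           + (a + 2 * d) * (2 * e + m / e)"
proof -
  define s where "s i = expectation (\<lambda>\<omega>. (X i \<omega>)\<^sup>2)" for i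
  define S where "S \<omega> = (\<Sum>i\<in>I. X i \<omega>)" for \<omega>
  define K where "K = (a + 2 * d) * (2 * e + m / e)"
  let ?L = "\<lambda>i. LINT \<omega>:{\<omega>\<in>space M. \<bar>X i \<omega>\<bar> > e}|M. (X i \<omega>)\<^sup>2"
  have "0 \<le> d" using d[of 0] by linarith
  have s_nonneg: "0 \<le> s i" for i by (simp add: s_def)
  have X_meas[measurable]: "X i \<in> borel_measurable M" if "i \<in> I" for i
    using indep that by (auto simp: indep_vars_def)
  have [measurable]: "S \<in> borel_measurable M" unfolding S_def by measurable
  have "continuous_on UNIV f" using D by (meson DERIV_isCont continuous_at_imp_continuous_on)
  then have [measurable]: "f \<in> borel_measurable borel" by (rule borel_measurable_continuous_onI)
  have int_f': "integrable M (\<lambda>\<omega>. f' (S \<omega>))"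
    using d by (intro integrable_const_bound[of _ d]) auto
  have int_Xf: "integrable M (\<lambda>\<omega>. X i \<omega> * f (S \<omega>))" if "i \<in> I" for i
  proof -
    have "integrable M (X i)" using X2 X_meas that by (auto intro: square_integrable_imp_integrable)
    then show ?thesis by (rule integrable_mult_bounded[OF _ _ B]) measurable
  qed
  have summand: "\<bar>expectation (\<lambda>\<omega>. X i \<omega> * f (S \<omega>)) - s i * expectation (\<lambda>\<omega>. f' (S \<omega>))\<bar>
      \<le> 2 * d * ?L i + s i * K" if i: "i \<in> I" for i
  proof -
    let ?J = "I - {i}"
    let ?W = "\<lambda>\<omega>. \<Sum>j\<in>?J. X j \<omega>"
    have S_eq: "S = (\<lambda>\<omega>. ?W \<omega> + X i \<omega>)"
      using fin i by (auto simp: S_def fun_eq_iff sum.remove)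
    have indep_i: "indep_var borel (X i) borel ?W"
      using fin i indep by (intro indep_vars_sum) (auto simp: insert_absorb)
    have "indep_vars (\<lambda>_. borel) X ?J" using indep by (rule indep_vars_subset) auto
    then have W: "integrable M (\<lambda>\<omega>. (?W \<omega>)\<^sup>2) \<and> expectation (\<lambda>\<omega>. (?W \<omega>)\<^sup>2) = (\<Sum>j\<in>?J. s j)"
      unfolding s_def using fin X2 EX by (intro indep_vars_sum_second_moment) auto
    have "(\<Sum>j\<in>?J. s j) \<le> (\<Sum>j\<in>I. s j)"
      by (rule sum_mono2[OF fin]) (simp_all add: s_nonneg)
    then have "(\<Sum>j\<in>?J. s j) \<le> 1" unfolding s_def var .
    then have W_le: "expectation (\<lambda>\<omega>. (?W \<omega>)\<^sup>2) \<le> 1" using W by simp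
    have "\<bar>expectation (\<lambda>\<omega>. X i \<omega> * f (S \<omega>)) - s i * expectation (\<lambda>\<omega>. f' (S \<omega>))\<bar>
        \<le> 2 * d * ?L i + s i * ((a + 2 * d) * (2 * e + s i / e))"
      unfolding S_eq s_def
      by (rule stein_summand_bound[OF indep_i X2[OF i] EX[OF i] conjunct1[OF W] W_le D _ B d modulus a e])
        simp
    \<comment> \<open>Only one of the two factors \<open>s i\<close> is replaced by its upper bound
      \<open>m\<close>; the other is kept as the weight.\<close>
    also have "\<dots> \<le> 2 * d * ?L i + s i * K"
      unfolding K_def using s_nonneg a \<open>0 \<le> d\<close> e max[OF i]
      by (intro add_left_mono mult_left_mono) (auto simp: s_def divide_right_mono)
    finally show ?thesis .
  qed
  have "expectation (\<lambda>\<omega>. f' (S \<omega>) - S \<omega> * f (S \<omega>))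
      = (\<Sum>i\<in>I. s i) * expectation (\<lambda>\<omega>. f' (S \<omega>)) - (\<Sum>i\<in>I. expectation (\<lambda>\<omega>. X i \<omega> * f (S \<omega>)))"
  proof -
    have "(\<lambda>\<omega>. S \<omega> * f (S \<omega>)) = (\<lambda>\<omega>. \<Sum>i\<in>I. X i \<omega> * f (S \<omega>))"
      by (simp add: S_def sum_distrib_right)
    then show ?thesis using int_f' int_Xf var by (simp add: s_def)
  qed
  also have "\<dots> = - (\<Sum>i\<in>I. expectation (\<lambda>\<omega>. X i \<omega> * f (S \<omega>)) - s i * expectation (\<lambda>\<omega>. f' (S \<omega>)))"
    by (simp add: sum_subtractf sum_distrib_right)
  finally have "\<bar>expectation (\<lambda>\<omega>. f' (S \<omega>) - S \<omega> * f (S \<omega>))\<bar>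
      \<le> (\<Sum>i\<in>I. \<bar>expectation (\<lambda>\<omega>. X i \<omega> * f (S \<omega>)) - s i * expectation (\<lambda>\<omega>. f' (S \<omega>))\<bar>)"
    by simp
  also have "\<dots> \<le> (\<Sum>i\<in>I. 2 * d * ?L i + s i * K)" by (rule sum_mono[OF summand])
  also have "\<dots> = 2 * d * (\<Sum>i\<in>I. ?L i) + (\<Sum>i\<in>I. s i) * K"
    by (simp add: sum.distrib sum_distrib_left sum_distrib_right)
  also have "(\<Sum>i\<in>I. s i) * K = K" using var by (simp add: s_def)
  finally show ?thesis by (simp add: S_def K_def)
qed

section \<open>Prokhorov distance\<close>

text \<open>On a nonempty set the extended infimum is finite and agrees with the real one. The form
  with \<open>infdist\<close> gives access to continuity, and hence to measurability of the
  enlargement.\<close>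

lemma closed_enlargement_eq_infdist:
  assumes "A \<noteq> {}"
  shows "closed_enlargement A \<delta> = {x. infdist x A \<le> \<delta>}"
proof -
  have "(INF a\<in>A. ereal \<bar>x - a\<bar>) = ereal (infdist x A)" for x
    using assms ereal_Inf'[of "(\<lambda>a. \<bar>x - a\<bar>) ` A"]
    by (simp add: infdist_notempty dist_real_def image_image bdd_belowI2[of _ 0])
  then show ?thesis by (simp add: closed_enlargement_def)
qed

text \<open>For empty \<open>A\<close> the convention \<open>infdist x {} = 0\<close> makes this
  identically 1, so it is applied to nonempty sets only.\<close>

definition tent :: "real set \<Rightarrow> real \<Rightarrow> real \<Rightarrow> real" where
  "tent A \<delta> x = max 0 (1 - infdist x A / \<delta>)"

lemma tent_nonneg: "0 \<le> tent A \<delta> x"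
  by (simp add: tent_def)

lemma tent_le_1: "0 < \<delta> \<Longrightarrow> tent A \<delta> x \<le> 1"
  by (simp add: tent_def infdist_nonneg)

lemma tent_eq_1: "x \<in> A \<Longrightarrow> tent A \<delta> x = 1"
  by (simp add: tent_def)

lemma tent_eq_0: "0 < \<delta> \<Longrightarrow> \<delta> < infdist x A \<Longrightarrow> tent A \<delta> x = 0"
  by (simp add: tent_def)

lemma tent_lipschitz:
  assumes "0 < \<delta>"
  shows "\<bar>tent A \<delta> x - tent A \<delta> y\<bar> \<le> 1 / \<delta> * \<bar>x - y\<bar>"
proof -
  have "\<bar>tent A \<delta> x - tent A \<delta> y\<bar> \<le> \<bar>infdist x A / \<delta> - infdist y A / \<delta>\<bar>"
    unfolding tent_def by linarith
  also have "\<dots> = \<bar>infdist x A - infdist y A\<bar> / \<delta>"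
    using assms by (simp add: diff_divide_distrib[symmetric])
  also have "\<dots> \<le> \<bar>x - y\<bar> / \<delta>"
    using assms infdist_triangle_abs[of x A y] by (simp add: divide_right_mono dist_real_def)
  finally show ?thesis by simp
qed

lemma continuous_on_tent: "0 < \<delta> \<Longrightarrow> continuous_on UNIV (tent A \<delta>)"
  unfolding tent_def[abs_def] by (intro continuous_intros) auto

text \<open>Every admissible value bounds the infimum, as the admissible set is bounded below by 0.
  The empty set satisfies the inequality trivially, which leaves the sets on which
  \<open>infdist\<close> is a genuine infimum.\<close>

lemma prokhorov_dist_le:
  assumes "0 < \<alpha>"
    and "\<And>A. A \<in> sets borel \<Longrightarrow> A \<noteq> {} \<Longrightarrow>
           measure P A \<le> measure Q (closed_enlargement A (l * \<alpha>)) + \<alpha>"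
  shows "prokhorov_dist l P Q \<le> \<alpha>"
  unfolding prokhorov_dist_def
proof (rule cInf_lower)
  have "measure P A \<le> measure Q (closed_enlargement A (l * \<alpha>)) + \<alpha>" if "A \<in> sets borel" for A
    using assms that by (cases "A = {}") (auto simp: add_nonneg_nonneg)
  then show "\<alpha> \<in> {\<alpha>. 0 < \<alpha> \<and> (\<forall>A\<in>sets borel.
      measure P A \<le> measure Q (closed_enlargement A (l * \<alpha>)) + \<alpha>)}"
    using assms(1) by simp
qed (auto intro!: bdd_belowI[of _ 0])

section \<open>Standard triangular arrays and the passage to the limit\<close>

context
  fixes M :: "'a measure" and X :: "nat \<Rightarrow> nat \<Rightarrow> 'a \<Rightarrow> real"
  assumes M: "prob_space M" and sta: "standard_triangular_array M X"
begin

interpretation prob_space M by (rule M)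

text \<open>The Stein equation, evaluated at the row sum, turns the left side into the quantity of
  \<open>stein_sum_bound\<close> with \<open>d = 2\<close>; the coefficient \<open>2 * d\<close> is
  the 4. The test function enters the bound through \<open>L\<close> only, which makes it uniform
  over Borel sets.\<close>

lemma sta_smooth_bound:
  assumes n: "1 \<le> n" and e: "0 < e"
    and h01: "\<And>x. 0 \<le> h x" "\<And>x. h x \<le> 1"
    and cont: "continuous_on UNIV h" and L: "\<And>x y. \<bar>h x - h y\<bar> \<le> L * \<bar>x - y\<bar>"
  shows "\<bar>expectation (\<lambda>\<omega>. h (\<Sum>k=1..n. X n k \<omega>)) - (\<integral>t. std_normal_density t * h t \<partial>lborel)\<bar>
    \<le> 4 * (\<Sum>k=1..n. LINT \<omega>:{\<omega>\<in>space M. \<bar>X n k \<omega>\<bar> > e}|M. (X n k \<omega>)\<^sup>2)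
      + (L + 1 / std_normal_density 1 + 4)
        * (2 * e + Max ((\<lambda>k. expectation (\<lambda>\<omega>. (X n k \<omega>)\<^sup>2)) ` {1..n}) / e)"
proof -
  let ?m = "\<integral>t. std_normal_density t * h t \<partial>lborel" and ?S = "\<lambda>\<omega>. \<Sum>k=1..n. X n k \<omega>"
  have indep: "indep_vars (\<lambda>_. borel) (X n) {1..n}"
    and X2: "\<And>k. k \<in> {1..n} \<Longrightarrow> integrable M (\<lambda>\<omega>. (X n k \<omega>)\<^sup>2)"
    and EX: "\<And>k. k \<in> {1..n} \<Longrightarrow> expectation (X n k) = 0"
    and var: "(\<Sum>k=1..n. expectation (\<lambda>\<omega>. (X n k \<omega>)\<^sup>2)) = 1"
    using sta[unfolded standard_triangular_array_def, rule_format, OF n] by simp_all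
  obtain f f' where D: "\<And>x. (f has_real_derivative f' x) (at x)"
    and eq: "\<And>x. f' x - x * f x = h x - ?m"
    and B: "\<And>x. \<bar>f x\<bar> \<le> 1 / std_normal_density 1" and d: "\<And>x. \<bar>f' x\<bar> \<le> 2"
    by (rule stein_equation_solution[OF cont h01]) (rule that)
  have "continuous_on UNIV f" using D by (meson DERIV_isCont continuous_at_imp_continuous_on)
  then have "continuous_on UNIV (\<lambda>x. x * f x + (h x - ?m))" by (intro continuous_intros cont)
  \<comment> \<open>The equation itself exhibits \<open>f'\<close> as continuous, which supplies its
    measurability.\<close>
  moreover have "f' = (\<lambda>x. x * f x + (h x - ?m))" using eq by (auto simp: fun_eq_iff algebra_simps)
  ultimately have f'_meas: "f' \<in> borel_measurable borel"
    by (simp add: borel_measurable_continuous_onI)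
  have "0 \<le> L" using L[of 0 1] by simp
  then have a: "0 \<le> L + 1 / std_normal_density 1" by (simp add: normal_density_pos)
  have h_meas[measurable]: "h \<in> borel_measurable borel"
    using cont by (rule borel_measurable_continuous_onI)
  have X_meas[measurable]: "X n k \<in> borel_measurable M" if "k \<in> {1..n}" for k
    using indep that by (auto simp: indep_vars_def)
  have [measurable]: "?S \<in> borel_measurable M" by measurable
  have "integrable M (\<lambda>\<omega>. h (?S \<omega>))"
  proof (rule integrable_const_bound)
    show "AE \<omega> in M. norm (h (?S \<omega>)) \<le> 1" using h01 by simp
  qed measurable
  then have "expectation (\<lambda>\<omega>. h (?S \<omega>)) - ?m = expectation (\<lambda>\<omega>. f' (?S \<omega>) - ?S \<omega> * f (?S \<omega>))"
    unfolding eq by (simp add: prob_space)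
  also have "\<bar>\<dots>\<bar> \<le> 2 * 2 * (\<Sum>k=1..n. LINT \<omega>:{\<omega>\<in>space M. \<bar>X n k \<omega>\<bar> > e}|M. (X n k \<omega>)\<^sup>2)
      + (L + 1 / std_normal_density 1 + 2 * 2)
        * (2 * e + Max ((\<lambda>k. expectation (\<lambda>\<omega>. (X n k \<omega>)\<^sup>2)) ` {1..n}) / e)"
    by (rule stein_sum_bound[OF _ indep X2 EX var _ D f'_meas B d
          stein_derivative_modulus[OF D eq B d L] a e]) auto
  finally show ?thesis by simp
qed

text \<open>The number \<open>\<alpha>\<close> plays two roles: it is the additive error, and
  \<open>l * \<alpha>\<close> is the enlargement radius, so the tent has Lipschitz constant
  \<open>1 / (l * \<alpha>)\<close>. Assumption \<open>le\<close> asks that the smooth bound for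
  this tent fit below the same \<open>\<alpha>\<close>. The tent lies between the indicators of
  \<open>A\<close> and of its enlargement.\<close>

lemma prokhorov_dist_rv_sta_le:
  assumes \<xi>: "distributed M lborel \<xi> std_normal_density"
    and n: "1 \<le> n" and e: "0 < e" and l: "0 < l" and \<alpha>: "0 < \<alpha>"
    and le: "4 * (\<Sum>k=1..n. LINT \<omega>:{\<omega>\<in>space M. \<bar>X n k \<omega>\<bar> > e}|M. (X n k \<omega>)\<^sup>2)
      + (1 / (l * \<alpha>) + 1 / std_normal_density 1 + 4)
        * (2 * e + Max ((\<lambda>k. expectation (\<lambda>\<omega>. (X n k \<omega>)\<^sup>2)) ` {1..n}) / e) \<le> \<alpha>"
  shows "prokhorov_dist_rv M l \<xi> (\<lambda>\<omega>. \<Sum>k=1..n. X n k \<omega>) \<le> \<alpha>"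
  unfolding prokhorov_dist_rv_def
proof (rule prokhorov_dist_le[OF \<alpha>])
  fix A :: "real set"
  assume A[measurable]: "A \<in> sets borel" and "A \<noteq> {}"
  let ?S = "\<lambda>\<omega>. \<Sum>k=1..n. X n k \<omega>"
  let ?h = "tent A (l * \<alpha>)" and ?E = "closed_enlargement A (l * \<alpha>)"
  have \<delta>: "0 < l * \<alpha>" using l \<alpha> by simp
  have E_eq: "?E = {x. infdist x A \<le> l * \<alpha>}" by (rule closed_enlargement_eq_infdist) fact
  have [measurable]: "(\<lambda>x. infdist x A) \<in> borel_measurable borel"
    by (intro borel_measurable_continuous_onI continuous_intros)
  have [measurable]: "?E \<in> sets borel" unfolding E_eq by measurable
  have [measurable]: "?h \<in> borel_measurable borel"
    by (rule borel_measurable_continuous_onI[OF continuous_on_tent[OF \<delta>]])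
  have [measurable]: "\<xi> \<in> borel_measurable M"
    using distributed_measurable[OF \<xi>] by simp
  have "indep_vars (\<lambda>_. borel) (X n) {1..n}"
    using sta n unfolding standard_triangular_array_def by blast
  then have "X n k \<in> borel_measurable M" if "k \<in> {1..n}" for k
    using that by (auto simp: indep_vars_def)
  then have [measurable]: "?S \<in> borel_measurable M" by measurable
  interpret P: prob_space "distr M borel \<xi>" by (rule prob_space_distr) measurable
  interpret Q: prob_space "distr M borel ?S" by (rule prob_space_distr) measurable
  have h_bound: "\<bar>?h x\<bar> \<le> 1" for x using tent_nonneg[of A "l * \<alpha>" x] tent_le_1[OF \<delta>, of A x] by simp
  have "measure (distr M borel \<xi>) A = (\<integral>x. indicator A x \<partial>distr M borel \<xi>)" by simp
  also have "\<dots> \<le> (\<integral>x. ?h x \<partial>distr M borel \<xi>)"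
  proof (rule integral_mono)
    show "integrable (distr M borel \<xi>) ?h"
      using h_bound by (intro P.integrable_const_bound[of _ 1]) auto
    show "indicator A x \<le> ?h x" for x
      by (simp add: indicator_def tent_eq_1 tent_nonneg)
    show "integrable (distr M borel \<xi>) (indicator A :: real \<Rightarrow> real)"
      by (intro P.integrable_const_bound[of _ 1]) (auto simp: indicator_def)
  qed
  also have "\<dots> = expectation (\<lambda>\<omega>. ?h (\<xi> \<omega>))" by (rule integral_distr) measurable
  also have "\<dots> = (\<integral>t. std_normal_density t * ?h t \<partial>lborel)"
    using distributed_integral[OF \<xi>, of ?h] by simp
  also have "\<dots> \<le> expectation (\<lambda>\<omega>. ?h (?S \<omega>)) + \<alpha>"
    using sta_smooth_bound[OF n e tent_nonneg tent_le_1[OF \<delta>] continuous_on_tent[OF \<delta>]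
        tent_lipschitz[OF \<delta>], of A] le
    by linarith
  also have "expectation (\<lambda>\<omega>. ?h (?S \<omega>)) = (\<integral>x. ?h x \<partial>distr M borel ?S)"
    by (rule integral_distr[symmetric]) measurable
  also have "\<dots> \<le> (\<integral>x. indicator ?E x \<partial>distr M borel ?S)"
  proof (rule integral_mono)
    show "integrable (distr M borel ?S) ?h"
      using h_bound by (intro Q.integrable_const_bound[of _ 1]) auto
    show "?h x \<le> indicator ?E x" for x
      by (simp add: indicator_def E_eq not_le tent_le_1[OF \<delta>] tent_eq_0[OF \<delta>])
    show "integrable (distr M borel ?S) (indicator ?E :: real \<Rightarrow> real)"
      by (intro Q.integrable_const_bound[of _ 1]) (auto simp: indicator_def)
  qed
  also have "\<dots> = measure (distr M borel ?S) ?E" by simp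
  finally show "measure (distr M borel \<xi>) A \<le> measure (distr M borel ?S) ?E + \<alpha>" by simp
qed

text \<open>The parameter \<open>l\<close> enters only through \<open>K\<close>, and
  \<open>K\<close> multiplies quantities that become small by the choice of \<open>e\<close> and by
  Feller's condition. This is why the constant 4 does not depend on \<open>l\<close>.\<close>

lemma limsup_prokhorov_dist_le:
  assumes feller: "feller_condition M X"
    and \<xi>: "distributed M lborel \<xi> std_normal_density" and l: "0 < l"
  shows "limsup (\<lambda>n. ereal (prokhorov_dist_rv M l \<xi> (\<lambda>\<omega>. \<Sum>k=1..n. X n k \<omega>)))
           \<le> 4 * lindeberg_index M X"
proof -
  let ?\<Lambda> = "\<lambda>e n. \<Sum>k=1..n. LINT \<omega>:{\<omega>\<in>space M. \<bar>X n k \<omega>\<bar> > e}|M. (X n k \<omega>)\<^sup>2"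
  let ?m = "\<lambda>n. Max ((\<lambda>k. expectation (\<lambda>\<omega>. (X n k \<omega>)\<^sup>2)) ` {1..n})"
  have index: "limsup (\<lambda>n. ereal (?\<Lambda> e n)) \<le> lindeberg_index M X" if "0 < e" for e
    unfolding lindeberg_index_def using that by (intro SUP_upper) auto
  have "0 \<le> ?\<Lambda> e n" for e n
    by (intro sum_nonneg) (simp add: set_lebesgue_integral_def)
  then have "0 \<le> limsup (\<lambda>n. ereal (?\<Lambda> 1 n))" by (intro le_Limsup) auto
  \<comment> \<open>Rules out the value minus infinity; for an infinite index the claim is
    trivial.\<close>
  then have index_nonneg: "0 \<le> lindeberg_index M X" using index[of 1] by simp
  show ?thesis
  proof (cases "lindeberg_index M X")
    case PInf
    then show ?thesis by simp
  next
    case MInf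
    then show ?thesis using index_nonneg by simp
  next
    case (real b)
    then have "0 \<le> b" using index_nonneg by simp
    have "limsup (\<lambda>n. ereal (prokhorov_dist_rv M l \<xi> (\<lambda>\<omega>. \<Sum>k=1..n. X n k \<omega>))) \<le> ereal (4 * b) + ereal \<eta>"
      if "0 < \<eta>" for \<eta>
    proof -
      \<comment> \<open>The extra \<open>\<eta>\<close> keeps \<open>\<alpha>\<close> positive when
        \<open>b = 0\<close>, so the Lipschitz constant of the tents stays finite and independent of
        \<open>n\<close>.\<close>
      define \<alpha> where "\<alpha> = 4 * b + \<eta>"
      define K where "K = 1 / (l * \<alpha>) + 1 / std_normal_density 1 + 4"
      \<comment> \<open>The truncation level is fixed before \<open>n\<close> tends to infinity, so
        that the term \<open>K * (2 * e)\<close> takes exactly a quarter of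
        \<open>\<eta>\<close>.\<close>
      define e where "e = \<eta> / (8 * K)"
      have "0 < \<alpha>" using \<open>0 \<le> b\<close> \<open>0 < \<eta>\<close> by (simp add: \<alpha>_def)
      then have "0 < K" using l by (simp add: K_def add_pos_pos normal_density_pos)
      then have "0 < e" using \<open>0 < \<eta>\<close> by (simp add: e_def)
      have Ke: "K * (2 * e) = \<eta> / 4" using \<open>0 < K\<close> by (simp add: e_def field_simps)
      have "limsup (\<lambda>n. ereal (?\<Lambda> e n)) \<le> ereal b"
        using index[OF \<open>0 < e\<close>] unfolding real .
      also have "\<dots> < ereal (b + \<eta> / 8)" using \<open>0 < \<eta>\<close> by simp
      finally have "\<forall>\<^sub>F n in sequentially. ereal (?\<Lambda> e n) < ereal (b + \<eta> / 8)"
        by (rule Limsup_lessD)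
      then have "\<forall>\<^sub>F n in sequentially. ?\<Lambda> e n < b + \<eta> / 8"
        by (simp only: less_ereal.simps(1))
      moreover have "(\<lambda>n. K * (?m n / e)) \<longlonglongrightarrow> K * (0 / e)"
        using feller \<open>0 < e\<close> unfolding feller_condition_def by (intro tendsto_intros) auto
      then have "\<forall>\<^sub>F n in sequentially. K * (?m n / e) < \<eta> / 4"
        using \<open>0 < \<eta>\<close> by (intro order_tendstoD(2)) auto
      ultimately have "\<forall>\<^sub>F n in sequentially.
          prokhorov_dist_rv M l \<xi> (\<lambda>\<omega>. \<Sum>k=1..n. X n k \<omega>) \<le> \<alpha>"
        using eventually_ge_at_top[of 1]
      proof eventually_elim
        case (elim n)
        \<comment> \<open>The slack \<open>\<eta>\<close> is spent as one half on the Lindeberg sum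
          (4 times \<open>\<eta> / 8\<close>), one quarter on \<open>K * (2 * e)\<close> and one
          quarter on the Feller term.\<close>
        have "4 * ?\<Lambda> e n + K * (2 * e + ?m n / e) \<le> \<alpha>"
          unfolding distrib_left[of K] Ke \<alpha>_def using elim(1,2) \<open>0 < \<eta>\<close> by linarith
        then show ?case
          unfolding K_def using elim(3) \<open>0 < e\<close> l \<open>0 < \<alpha>\<close> by (intro prokhorov_dist_rv_sta_le[OF \<xi>])
      qed
      then show ?thesis by (intro Limsup_bounded) (simp add: \<alpha>_def)
    qed
    then have "limsup (\<lambda>n. ereal (prokhorov_dist_rv M l \<xi> (\<lambda>\<omega>. \<Sum>k=1..n. X n k \<omega>))) \<le> ereal (4 * b)"
      by (rule ereal_le_epsilon2)
    then show ?thesis using real by simp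
  qed
qed

end

theorem theorem4p5:
  fixes M :: "'a measure" and \<xi> :: "'a \<Rightarrow> real"
  assumes "prob_space M"
    and "distributed M lborel \<xi> std_normal_density"
  shows "(\<exists>C::real. C > 0 \<and>
           (\<forall>(l::real) (X :: nat \<Rightarrow> nat \<Rightarrow> 'a \<Rightarrow> real).
              l > 0 \<longrightarrow> standard_triangular_array M X \<longrightarrow> feller_condition M X \<longrightarrow>
              limsup (\<lambda>n. ereal (prokhorov_dist_rv M l \<xi> (\<lambda>\<omega>. \<Sum>k=1..n. X n k \<omega>)))
                \<le> ereal C * lindeberg_index M X)) \<and>
         (\<forall>(l::real) (X :: nat \<Rightarrow> nat \<Rightarrow> 'a \<Rightarrow> real).
            l > 0 \<longrightarrow> standard_triangular_array M X \<longrightarrow> feller_condition M X \<longrightarrow>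
            limsup (\<lambda>n. ereal (prokhorov_dist_rv M l \<xi> (\<lambda>\<omega>. \<Sum>k=1..n. X n k \<omega>)))
              \<le> 4 * lindeberg_index M X)"
proof -
  have "limsup (\<lambda>n. ereal (prokhorov_dist_rv M l \<xi> (\<lambda>\<omega>. \<Sum>k=1..n. X n k \<omega>)))
      \<le> 4 * lindeberg_index M X"
    if "0 < l" "standard_triangular_array M X" "feller_condition M X" for l X
    using assms that by (intro limsup_prokhorov_dist_le) auto
  then show ?thesis by (intro conjI exI[of _ "4::real"]) simp_all
qed

end
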